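(* Let $H>0$, $\alpha>0$, $\beta>0$, and let $g:[0,H]\to(0,\infty)$ be continuously differentiable. Let $B$ be the solid of revolution generated by $g$, with surface area density $\alpha$, filled with a homogeneous material of volume density $\beta$ between the planes $P_0$ and $P_h$, and let $T_{sr}(h)$ be the distance from $P_0$ to the Center of Gravity of the solid with its content, $0\le h\le H$ (all as defined in the context). Then the Center of Gravity is at its lowest position if and only if it lies on the top surface of the material; that is, for every $h\in[0,H]$, $$T_{sr}(h)=\min_{0\le t\le H}T_{sr}(t)\quad\Longleftrightarrow\quad T_{sr}(h)=h .$$ Moreover, the value of this lowest position is the number $h$ given as the unique solution in $[0,H]$ of the equation $$\alpha S_0h+\pi\beta h\int_0^h g(y)^2\,dy-\alpha S_1-\pi\beta\int_0^h y\,g(y)^2\,dy=0 .$$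
   Context: Let $D=\{(x,0,z): 0\le x\le g(z),\ 0\le z\le H\}\subset\mathbb{R}^3$. The solid $B$ with surface $S$ is generated when the set $D$ and the curve $x=g(z)$, $0\le z\le H$, respectively, are rotated around the vertical $z$-axis (so $S$ is the lateral surface). $P_h$ denotes the horizontal plane $z=h$. The surface $S$ has constant area density $\alpha$, and the filling material has constant volume density $\beta$. The zeroth and first moments of $S$ relative to $P_0$ (without the density factor) are $$S_0=2\pi\int_0^H g(z)\sqrt{1+g'(z)^2}\,dz,\qquad S_1=2\pi\int_0^H z\,g(z)\sqrt{1+g'(z)^2}\,dz .$$ The distance from $P_0$ to the Center of Gravity of the solid $B$ (the surface $S$ together with the material filling it between $P_0$ and $P_h$) is $$T_{sr}(h)=\frac{\alpha S_1+\pi\beta\int_0^h z\,g(z)^2\,dz}{\alpha S_0+\pi\beta\int_0^h g(z)^2\,dz},\qquad 0\le h\le H .$$ *)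

theory Defs
  imports "HOL-Analysis.Analysis"
begin

(* S_0 and S_1: zeroth and first moments relative to the plane z = 0 of the surface of
   revolution of the curve x = g z, 0 <= z <= H, without the density factor.  The argument
   g' is the derivative of g on {0..H}, one-sided at the end points. *)

definition S0 :: "(real \<Rightarrow> real) \<Rightarrow> (real \<Rightarrow> real) \<Rightarrow> real \<Rightarrow> real" where
  "S0 g g' H = 2 * pi * integral {0..H} (\<lambda>z. g z * sqrt (1 + (g' z)\<^sup>2))"

definition S1 :: "(real \<Rightarrow> real) \<Rightarrow> (real \<Rightarrow> real) \<Rightarrow> real \<Rightarrow> real" where
  "S1 g g' H = 2 * pi * integral {0..H} (\<lambda>z. z * g z * sqrt (1 + (g' z)\<^sup>2))"

(* Height of the center of gravity of the surface (area density \<alpha>, full height H) together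
   with the material (volume density \<beta>) filling it between the planes z = 0 and z = h. *)

definition T_sr ::
  "real \<Rightarrow> real \<Rightarrow> (real \<Rightarrow> real) \<Rightarrow> (real \<Rightarrow> real) \<Rightarrow> real \<Rightarrow> real \<Rightarrow> real" where
  "T_sr \<alpha> \<beta> g g' H h =
     (\<alpha> * S1 g g' H + pi * \<beta> * integral {0..h} (\<lambda>z. z * (g z)\<^sup>2)) /
     (\<alpha> * S0 g g' H + pi * \<beta> * integral {0..h} (\<lambda>z. (g z)\<^sup>2))"

(* An attained minimum of a possibly infinite set; Min is meaningful only for finite sets,
   and Inf need not be attained. *)

definition is_minimum :: "real \<Rightarrow> real set \<Rightarrow> bool" where
  "is_minimum m A \<longleftrightarrow> m \<in> A \<and> (\<forall>a\<in>A. m \<le> a)"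

end

theory Submission
  imports Defs
begin

text \<open>
  With \<open>N\<close> and \<open>D\<close> the numerator and denominator of the height of the center of gravity,
  the equilibrium equation reads \<open>N h = h * D h\<close>.  For fixed \<open>h\<close>, the function
  \<open>\<lambda>t. N t - h * D t\<close> is, up to a constant, the integral of \<open>(z - h) * w z\<close> with \<open>w > 0\<close>
  over \<open>{0..t}\<close>, so it has its strict minimum at \<open>t = h\<close>.  If \<open>h\<close> is an equilibrium,
  this minimum is \<open>0\<close>, which says \<open>N t / D t > h\<close> for all other \<open>t\<close>.  An equilibrium exists by
  the intermediate value theorem, since \<open>0 < S1 < H * S0\<close>.
\<close>

text \<open>The integrand has the sign of \<open>z - h\<close>. Going past \<open>h\<close> adds a
  positive piece over \<open>{h..t}\<close>; stopping short of \<open>h\<close> omits a negative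
  piece over \<open>{t..h}\<close>.\<close>

lemma integral_shifted_moment_less:
  fixes w :: "real \<Rightarrow> real"
  assumes w: "continuous_on {0..H} w" "\<And>z. z \<in> {0..H} \<Longrightarrow> w z > 0"
    and h: "h \<in> {0..H}" and t: "t \<in> {0..H}" and "t \<noteq> h"
  shows "integral {0..h} (\<lambda>z. (z - h) * w z) < integral {0..t} (\<lambda>z. (z - h) * w z)"
proof -
  let ?f = "\<lambda>z. (z - h) * w z"
  have cont: "continuous_on {a..b} ?f" if "0 \<le> a" "b \<le> H" for a b
    using that by (intro continuous_intros continuous_on_subset[OF w(1)]) auto
  have int: "?f integrable_on {a..b}" if "0 \<le> a" "b \<le> H" for a b
    using cont[OF that] integrable_continuous_real by blast
  show ?thesis
  proof (cases "h < t")
    case True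
    \<comment> \<open>The zero of the integrand at \<open>z = h\<close> is harmless: strict
      inequality is needed only on the open interval.\<close>
    have "0 < integral {h..t} ?f"
      using integral_less_real[of h t "\<lambda>_. 0" ?f] cont[of h t] True h t w(2) by auto
    with Henstock_Kurzweil_Integration.integral_combine[where f = ?f and a = 0 and c = h and b = t] int[of 0 t] True h t show ?thesis by auto
  next
    case False
    have "integral {t..h} ?f < 0"
      using integral_less_real[of t h ?f "\<lambda>_. 0"] cont[of t h] False \<open>t \<noteq> h\<close> h t w(2)
      by (auto simp: mult_neg_pos)
    with Henstock_Kurzweil_Integration.integral_combine[where f = ?f and a = 0 and c = t and b = h] int[of 0 h] False h t show ?thesis by auto
  qed
qed

text \<open>The center of gravity of the bare surface lies strictly between the planes at heights
  \<open>0\<close> and \<open>H\<close>, because the weight \<open>?w\<close> is positive. This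
  fixes the endpoint signs for the intermediate value theorem.\<close>

lemma S0_S1_bounds:
  fixes g g' :: "real \<Rightarrow> real"
  assumes "H > 0" and g: "continuous_on {0..H} g" and g': "continuous_on {0..H} g'"
    and pos: "\<And>z. z \<in> {0..H} \<Longrightarrow> g z > 0"
  shows "S0 g g' H > 0" and "S1 g g' H > 0" and "S1 g g' H < H * S0 g g' H"
proof -
  let ?w = "\<lambda>z. g z * sqrt (1 + (g' z)\<^sup>2)"
  have cont: "continuous_on {0..H} ?w"
    by (intro continuous_intros g g')
  have w: "?w z > 0" if "z \<in> {0..H}" for z
    using pos[OF that] by (intro mult_pos_pos) (auto simp: add_pos_nonneg)
  have cont1: "continuous_on {0..H} (\<lambda>z. z * ?w z)" "continuous_on {0..H} (\<lambda>z. H * ?w z)"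
    by (intro continuous_intros cont)+
  have "0 < integral {0..H} ?w"
    using integral_less_real[of 0 H "\<lambda>_. 0" ?w] cont w \<open>H > 0\<close> by auto
  then show "S0 g g' H > 0" by (simp add: S0_def)
  have "0 < integral {0..H} (\<lambda>z. z * ?w z)"
    using integral_less_real[of 0 H "\<lambda>_. 0" "\<lambda>z. z * ?w z"] cont1 w \<open>H > 0\<close> by auto
  then show "S1 g g' H > 0" by (simp add: S1_def mult.assoc)
  have "z * ?w z < H * ?w z" if "z \<in> {0<..<H}" for z
    using that w[of z] by (intro mult_strict_right_mono) auto
  then have "integral {0..H} (\<lambda>z. z * ?w z) < integral {0..H} (\<lambda>z. H * ?w z)"
    using integral_less_real[OF cont1] \<open>H > 0\<close> by auto
  then show "S1 g g' H < H * S0 g g' H" by (simp add: S0_def S1_def mult.assoc mult.left_commute)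
qed

text \<open>Abstract form of the problem: \<open>m0\<close> and \<open>m1\<close> are the moments of
  the shell, \<open>w\<close> and \<open>c\<close> describe the filling. The strict inequality in
  the last claim yields both minimality and uniqueness of an equilibrium.\<close>

lemma moment_quotient_equilibrium:
  fixes w :: "real \<Rightarrow> real"
  assumes "H > 0" and w: "continuous_on {0..H} w" "\<And>z. z \<in> {0..H} \<Longrightarrow> w z > 0"
    and m: "0 < m0" "0 < m1" "m1 < H * m0" and "c > 0"
  defines "N \<equiv> \<lambda>t. m1 + c * integral {0..t} (\<lambda>z. z * w z)"
    and "D \<equiv> \<lambda>t. m0 + c * integral {0..t} w"
  shows "\<exists>h\<in>{0..H}. N h = h * D h" (is ?ex)
    and "\<And>t. t \<in> {0..H} \<Longrightarrow> D t > 0"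
    and "\<And>h t. \<lbrakk>h \<in> {0..H}; t \<in> {0..H}; N h = h * D h; t \<noteq> h\<rbrakk> \<Longrightarrow> h < N t / D t"
proof -
  have cont: "continuous_on {0..t} w" "continuous_on {0..t} (\<lambda>z. z * w z)" if "t \<in> {0..H}" for t
    using that by (auto intro!: continuous_intros continuous_on_subset[OF w(1)])
  have int: "w integrable_on {0..t}" "(\<lambda>z. z * w z) integrable_on {0..t}" if "t \<in> {0..H}" for t
    using cont[OF that] integrable_continuous_real by blast+
  show Dpos: "D t > 0" if t: "t \<in> {0..H}" for t
  proof -
    have "integral {0..t} w \<ge> 0"
      using t w(2) by (intro integral_nonneg int) (auto simp: less_imp_le)
    with m \<open>c > 0\<close> show ?thesis by (simp add: D_def add_pos_nonneg)
  qed
  \<comment> \<open>Moments are taken about the level \<open>h\<close>, which stays fixed while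
    \<open>t\<close> varies.\<close>
  have diff: "N t - h * D t = m1 - h * m0 + c * integral {0..t} (\<lambda>z. (z - h) * w z)"
    if "t \<in> {0..H}" for h t
  proof -
    have "integral {0..t} (\<lambda>z. (z - h) * w z)
        = integral {0..t} (\<lambda>z. z * w z) - h * integral {0..t} w"
      using int[OF that] by (simp add: left_diff_distrib mult.assoc integral_diff integrable_on_mult_right)
    then show ?thesis
      by (simp only: N_def D_def right_diff_distrib distrib_left) (simp add: mult.left_commute)
  qed
  have less: "N h - h * D h < N t - h * D t" if "h \<in> {0..H}" "t \<in> {0..H}" "t \<noteq> h" for h t
    using integral_shifted_moment_less[OF w that] \<open>c > 0\<close> that by (simp add: diff)
  show "h < N t / D t" if "h \<in> {0..H}" "t \<in> {0..H}" "N h = h * D h" "t \<noteq> h" for h t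
    using less[of h t] that Dpos[of t] by (simp add: pos_less_divide_eq)
  \<comment> \<open>Moments about the level \<open>H\<close> compare the full and the empty solid.
    The right side is \<open>m1 - H * m0 < 0\<close>, while \<open>N t - t * D t\<close> at
    \<open>t = 0\<close> is \<open>m1 > 0\<close>.\<close>
  have "N H - H * D H < N 0 - H * D 0"
    using less[of H 0] \<open>H > 0\<close> by simp
  then have H: "N H - H * D H \<le> 0" using m by (simp add: N_def D_def)
  have "continuous_on {0..H} (\<lambda>t. N t - t * D t)"
    unfolding N_def D_def using \<open>H > 0\<close>
    by (intro continuous_intros indefinite_integral_continuous_1 int) auto
  then obtain h where "0 \<le> h" "h \<le> H" "N h - h * D h = 0"
    using IVT2'[of "\<lambda>t. N t - t * D t" H 0 0] H m \<open>H > 0\<close> by (auto simp: N_def D_def)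
  then show ?ex by auto
qed

theorem theorem2:
  fixes H \<alpha> \<beta> :: real and g g' :: "real \<Rightarrow> real"
  assumes "H > 0" and "\<alpha> > 0" and "\<beta> > 0"
    and "\<And>z. z \<in> {0..H} \<Longrightarrow> g z > 0"
    and "\<And>z. z \<in> {0..H} \<Longrightarrow> (g has_real_derivative g' z) (at z within {0..H})"
    and "continuous_on {0..H} g'"
  defines "T \<equiv> T_sr \<alpha> \<beta> g g' H"
  defines "equilibrium \<equiv> \<lambda>h. \<alpha> * S0 g g' H * h + pi * \<beta> * h * integral {0..h} (\<lambda>y. (g y)\<^sup>2)
             - \<alpha> * S1 g g' H - pi * \<beta> * integral {0..h} (\<lambda>y. y * (g y)\<^sup>2) = 0"
  shows "(\<forall>h\<in>{0..H}. is_minimum (T h) (T ` {0..H}) \<longleftrightarrow> T h = h) \<and>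
         (\<exists>!h. h \<in> {0..H} \<and> equilibrium h) \<and>
         (\<forall>h\<in>{0..H}. equilibrium h \<longrightarrow> is_minimum h (T ` {0..H}))"
proof -
  define N where "N t = \<alpha> * S1 g g' H + pi * \<beta> * integral {0..t} (\<lambda>z. z * (g z)\<^sup>2)" for t
  define D where "D t = \<alpha> * S0 g g' H + pi * \<beta> * integral {0..t} (\<lambda>z. (g z)\<^sup>2)" for t
  have g: "continuous_on {0..H} g"
    using assms(5) DERIV_continuous_on by blast
  note S = S0_S1_bounds[OF \<open>H > 0\<close> g assms(6,4)]
  have w: "continuous_on {0..H} (\<lambda>z. (g z)\<^sup>2)" "\<And>z. z \<in> {0..H} \<Longrightarrow> (g z)\<^sup>2 > 0"
    using g assms(4) by (auto intro!: continuous_intros simp: less_imp_neq[THEN not_sym])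
  have m: "0 < \<alpha> * S0 g g' H" "0 < \<alpha> * S1 g g' H" "\<alpha> * S1 g g' H < H * (\<alpha> * S0 g g' H)"
    "0 < pi * \<beta>"
    using S \<open>\<alpha> > 0\<close> \<open>\<beta> > 0\<close> by (auto simp: mult.left_commute)
  note min = moment_quotient_equilibrium[OF \<open>H > 0\<close> w m, folded N_def D_def]
  have T: "T t = N t / D t" for t
    by (simp add: T_def T_sr_def N_def D_def)
  have eq_iff: "equilibrium h \<longleftrightarrow> N h = h * D h" for h
    unfolding equilibrium_def N_def D_def by (auto simp: algebra_simps)
  have fixp: "T h = h \<longleftrightarrow> equilibrium h" if "h \<in> {0..H}" for h
    using min(2)[of h] that by (simp add: T eq_iff divide_eq_eq)
  have less: "h < T t" if "h \<in> {0..H}" "t \<in> {0..H}" "equilibrium h" "t \<noteq> h" for h t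
    using min(3)[of h t] that by (simp add: T eq_iff)
  obtain e where e: "e \<in> {0..H}" "equilibrium e"
    using min(1) eq_iff by blast
  \<comment> \<open>Two distinct equilibria would give both \<open>h < T e = e\<close> and
    \<open>e < T h = h\<close>.\<close>
  have unique: "h = e" if "h \<in> {0..H}" "equilibrium h" for h
    using less[of h e] less[of e h] that e fixp[of h] fixp[of e] by (cases "h = e") auto
  have "T e = e" using e fixp by blast
  have minimum: "is_minimum e (T ` {0..H})"
    unfolding is_minimum_def using e less[of e] \<open>T e = e\<close> by (force intro: less_imp_le)
  have "T h = h" if "h \<in> {0..H}" "is_minimum (T h) (T ` {0..H})" for h
  proof -
    have "T h \<le> e" using that(2) e \<open>T e = e\<close> unfolding is_minimum_def by force
    \<comment> \<open>Otherwise \<open>e < T h\<close>, against \<open>T h \<le> e\<close>.\<close>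
    then have "h = e" using less[of e h] that(1) e by force
    with \<open>T e = e\<close> show ?thesis by simp
  qed
  moreover have "is_minimum (T h) (T ` {0..H})" if "h \<in> {0..H}" "T h = h" for h
    using that unique fixp minimum by metis
  ultimately show ?thesis
    using e unique minimum by blast
qed

end
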